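(* Let $n$ be a positive integer, let $(X,\|\cdot,\dots,\cdot\|)$ be a real $n$-normed space, and let $Y=\{y_1,\dots,y_n\}$ be a linearly independent set of $n$ vectors in $X$, used to form the class-$m$ collections of $X$ for all $m\in\mathbb{N}$ with $1\le m\le n$. Let $K\subset X$ be nonempty. Then for every $m\in\mathbb{N}$ with $1\le m\le n$, the set $K$ is bounded with respect to the norms of the class-$1$ collection if and only if it is bounded with respect to the norms of the class-$m$ collection.
   Context: **$n$-norm.** Let $X$ be a real vector space with $\dim X\ge n$. An $n$-norm on $X$ is a function $\|\cdot,\dots,\cdot\|:X^n\to\mathbb{R}$ such that: (i) $\|x_1,\dots,x_n\|\ge 0$, with $\|x_1,\dots,x_n\|=0$ if and only if $x_1,\dots,x_n$ are linearly dependent; (ii) $\|x_1,\dots,x_n\|$ is invariant under permutation of its arguments; (iii) $\|\alpha x_1,x_2,\dots,x_n\|=|\alpha|\,\|x_1,x_2,\dots,x_n\|$ for all $\alpha\in\mathbb{R}$; (iv) $\|x_1+x_1',x_2,\dots,x_n\|\le\|x_1,x_2,\dots,x_n\|+\|x_1',x_2,\dots,x_n\|$. The pair $(X,\|\cdot,\dots,\cdot\|)$ is called an $n$-normed space. **Class-$m$ collection.** Fix a linearly independent set $Y=\{y_1,\dots,y_n\}\subset X$. For $1\le m\le n$ and indices $i_1<\dots<i_m$ in $\{1,\dots,n\}$, let $Y^0_{i_1,\dots,i_m}:=\mathrm{span}\,(Y\setminus\{y_{i_1},\dots,y_{i_m}\})$ and $X^*_{i_1,\dots,i_m}:=X/Y^0_{i_1,\dots,i_m}$,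 and write $\overline{u}$ for the coset of $u\in X$ in this quotient. The norm on $X^*_{i_1,\dots,i_m}$ is $$\|\overline{u}\|^*_{i_1,\dots,i_m}:=\sum_{s=1}^m \|u,y_1,\dots,y_{i_s-1},y_{i_s+1},\dots,y_n\|.$$ In particular, for $m=1$, $\|\overline{u}\|^*_j=\|u,y_1,\dots,y_{j-1},y_{j+1},\dots,y_n\|$. The class-$m$ collection is the set of all $\binom{n}{m}$ such quotient spaces, and "the norms of the class-$m$ collection" means all the norms $\|\cdot\|^*_{i_1,\dots,i_m}$ with $i_1<\dots<i_m$. **Boundedness.** A nonempty set $K\subseteq X$ is bounded with respect to the norms of the class-$m$ collection if there exists $M>0$ such that for all $x\in K$, $\|\overline{x}\|^*_{i_1,\dots,i_m}\le M$ for every $i_1<\dots<i_m$ in $\{1,\dots,n\}$. *)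

theory Defs
  imports "HOL-Analysis.Analysis" "HOL-Library.Set_Algebras" "HOL-Combinatorics.Permutations"
begin

text \<open>
  An \<open>n\<close>-tuple is a list of length \<open>n\<close>; the values of \<open>N\<close> on lists of any other length are
  irrelevant. Linear independence is that of the family, so a tuple with a repeated entry is
  dependent. The library's \<open>dim\<close> is \<open>0\<close> on infinite-dimensional spaces, so \<open>dim X \<ge> n\<close> is stated
  as the existence of \<open>n\<close> independent vectors.
\<close>

definition lin_indep_tuple :: "'a::real_vector list \<Rightarrow> bool" where
  "lin_indep_tuple xs \<longleftrightarrow> distinct xs \<and> independent (set xs)"

locale n_norm =
  fixes n :: nat and N :: "'a::real_vector list \<Rightarrow> real"
  assumes dim_ge: "\<exists>B::'a set. finite B \<and> card B = n \<and> independent B"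
    and nonneg: "length xs = n \<Longrightarrow> N xs \<ge> 0"
    and eq_0_iff: "length xs = n \<Longrightarrow> N xs = 0 \<longleftrightarrow> \<not> lin_indep_tuple xs"
    and permute: "length xs = n \<Longrightarrow> p permutes {..<n} \<Longrightarrow> N (permute_list p xs) = N xs"
    and scale: "length (x # xs) = n \<Longrightarrow> N ((a *\<^sub>R x) # xs) = \<bar>a\<bar> * N (x # xs)"
    and triangle: "length (x # xs) = n \<Longrightarrow> N ((x + x') # xs) \<le> N (x # xs) + N (x' # xs)"

text \<open>
  The vectors \<open>y\<^sub>1, \<dots>, y\<^sub>n\<close> are the values of \<open>y\<close> on \<open>{1..n}\<close>, and a choice of indices
  \<open>i\<^sub>1 < \<dots> < i\<^sub>m\<close> is the set \<open>I = {i\<^sub>1, \<dots>, i\<^sub>m}\<close>. An element of the quotient of the whole space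
  by a subspace \<open>S\<close> is a coset \<open>u +o S\<close>.
\<close>

definition class_indices :: "nat \<Rightarrow> nat \<Rightarrow> nat set set" where
  "class_indices n m = {I. I \<subseteq> {1..n} \<and> card I = m}"

definition Y0 :: "nat \<Rightarrow> (nat \<Rightarrow> 'a::real_vector) \<Rightarrow> nat set \<Rightarrow> 'a set" where
  "Y0 n y I = span (y ` {1..n} - y ` I)"

text \<open>The tuple \<open>(u, y\<^sub>1, \<dots>, y\<^bsub>i-1\<^esub>, y\<^bsub>i+1\<^esub>, \<dots>, y\<^sub>n)\<close>.\<close>

definition replace_tuple :: "nat \<Rightarrow> (nat \<Rightarrow> 'a) \<Rightarrow> nat \<Rightarrow> 'a \<Rightarrow> 'a list" where
  "replace_tuple n y i u = u # map y ([1..<i] @ [Suc i..<Suc n])"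

text \<open>
  The norm on the quotient is a function of the coset, computed from a chosen representative;
  \<open>quotient_norm_coset\<close> below shows that any representative gives the same value.
\<close>

definition quotient_norm ::
    "('a list \<Rightarrow> real) \<Rightarrow> nat \<Rightarrow> (nat \<Rightarrow> 'a::real_vector) \<Rightarrow> nat set \<Rightarrow> 'a set \<Rightarrow> real" where
  "quotient_norm N n y I C = (\<Sum>i\<in>I. N (replace_tuple n y i (SOME u. u \<in> C)))"

definition class_bounded ::
    "('a list \<Rightarrow> real) \<Rightarrow> nat \<Rightarrow> (nat \<Rightarrow> 'a::real_vector) \<Rightarrow> nat \<Rightarrow> 'a set \<Rightarrow> bool" where
  "class_bounded N n y m K \<longleftrightarrow>
     (\<exists>M>0. \<forall>x\<in>K. \<forall>I\<in>class_indices n m. quotient_norm N n y I (x +o Y0 n y I) \<le> M)"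

lemma (in n_norm) add_span:
  assumes len: "length (u # zs) = n" and v: "v \<in> span (set zs)"
  shows "N ((u + v) # zs) = N (u # zs)"
proof -
  have le: "N ((a + b) # zs) \<le> N (a # zs)" if b: "b \<in> span (set zs)" for a b
  proof -
    have "\<not> lin_indep_tuple (b # zs)"
      using b by (auto simp: lin_indep_tuple_def dependent_def span_base)
    then have "N (b # zs) = 0"
      using eq_0_iff[of "b # zs"] len by simp
    then show ?thesis
      using triangle[of a zs b] len by simp
  qed
  have "- v \<in> span (set zs)"
    using v by (rule span_neg)
  from le[OF this, of "u + v"] le[OF v, of u] show ?thesis
    by simp
qed

lemma (in n_norm) quotient_norm_coset:
  assumes I: "I \<subseteq> {1..n}"
  shows "quotient_norm N n y I (u +o Y0 n y I) = (\<Sum>i\<in>I. N (replace_tuple n y i u))"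
proof -
  define w where "w = (SOME w. w \<in> u +o Y0 n y I)"
  have "u \<in> u +o Y0 n y I"
    unfolding elt_set_plus_def Y0_def by (auto intro!: bexI[of _ 0] span_zero)
  then have "w \<in> u +o Y0 n y I"
    unfolding w_def by (rule someI)
  then obtain v where w: "w = u + v" and v: "v \<in> span (y ` {1..n} - y ` I)"
    unfolding elt_set_plus_def Y0_def by auto
  have "N (replace_tuple n y i w) = N (replace_tuple n y i u)" if i: "i \<in> I" for i
    unfolding replace_tuple_def w
  proof (rule add_span)
    show "length (u # map y ([1..<i] @ [Suc i..<Suc n])) = n"
      using i I by auto
    have "y ` {1..n} - y ` I \<subseteq> set (map y ([1..<i] @ [Suc i..<Suc n]))"
    proof
      fix z assume z: "z \<in> y ` {1..n} - y ` I"
      then obtain j where j: "z = y j" "j \<in> {1..n}" by auto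
      with z i have "j \<noteq> i" by auto
      with j have "j \<in> set ([1..<i] @ [Suc i..<Suc n])" by auto
      with j show "z \<in> set (map y ([1..<i] @ [Suc i..<Suc n]))"
        by (metis image_eqI set_map)
    qed
    then show "v \<in> span (set (map y ([1..<i] @ [Suc i..<Suc n])))"
      using v span_mono by blast
  qed
  then show ?thesis
    unfolding quotient_norm_def w_def by simp
qed

end

theory Submission
  imports Defs
begin

text \<open>
  Write \<open>N\<^sub>i(u)\<close> for the \<open>n\<close>-norm of \<open>u\<close> together with all the \<open>y\<^sub>j\<close>, \<open>j \<noteq> i\<close>. A norm of class
  \<open>m\<close> is a sum of \<open>m\<close> of the \<open>n\<close> nonnegative functions \<open>N\<^sub>1, \<dots>, N\<^sub>n\<close>. Every \<open>N\<^sub>i\<close> is a summand of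
  some norm of class \<open>m\<close>, so a bound on these norms bounds all \<open>N\<^sub>i\<close>; a common bound \<open>M\<close> on
  the \<open>N\<^sub>i\<close> bounds every sum of \<open>m\<close> of them by \<open>m M\<close>. Boundedness in class \<open>m\<close> is thus the same
  as a common bound on \<open>N\<^sub>1, \<dots>, N\<^sub>n\<close> (\<open>class_bounded_iff_replace_tuple_bounded\<close>), a condition in
  which \<open>m\<close> does not occur.
\<close>

lemma class_indices_containing:
  assumes "i \<in> {1..n}" "m \<in> {1..n}"
  obtains I where "I \<in> class_indices n m" "i \<in> I"
proof -
  have "m - 1 \<le> card ({1..n} - {i})"
    using assms by auto
  then obtain J where J: "J \<subseteq> {1..n} - {i}" "card J = m - 1" "finite J"
    by (rule obtain_subset_with_card_n)
  then have "i \<notin> J"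
    by auto
  with J assms have "insert i J \<in> class_indices n m"
    by (auto simp: class_indices_def)
  then show thesis
    using that by blast
qed

lemma (in n_norm) replace_tuple_nonneg:
  assumes "i \<in> {1..n}"
  shows "N (replace_tuple n y i u) \<ge> 0"
  by (rule nonneg) (use assms in \<open>auto simp: replace_tuple_def\<close>)

lemma (in n_norm) class_bounded_iff_replace_tuple_bounded:
  assumes m: "m \<in> {1..n}"
  shows "class_bounded N n y m K \<longleftrightarrow>
    (\<exists>M>0. \<forall>x\<in>K. \<forall>i\<in>{1..n}. N (replace_tuple n y i x) \<le> M)"
proof
  assume "class_bounded N n y m K"
  then obtain M where M: "M > 0"
    "\<And>x I. x \<in> K \<Longrightarrow> I \<in> class_indices n m \<Longrightarrow> quotient_norm N n y I (x +o Y0 n y I) \<le> M"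
    unfolding class_bounded_def by blast
  have "N (replace_tuple n y i x) \<le> M" if x: "x \<in> K" and i: "i \<in> {1..n}" for x i
  proof -
    obtain I where I: "I \<in> class_indices n m" "i \<in> I"
      using class_indices_containing[OF i m] .
    then have sub: "I \<subseteq> {1..n}"
      by (simp add: class_indices_def)
    then have "N (replace_tuple n y i x) \<le> (\<Sum>j\<in>I. N (replace_tuple n y j x))"
    proof (intro member_le_sum)
      show "finite I"
        using sub by (rule finite_subset) simp
    qed (use I sub replace_tuple_nonneg in blast)+
    also have "\<dots> = quotient_norm N n y I (x +o Y0 n y I)"
      using quotient_norm_coset[OF sub] by simp
    also have "\<dots> \<le> M"
      using M(2) x I by blast
    finally show ?thesis .
  qed
  with M(1) show "\<exists>M>0. \<forall>x\<in>K. \<forall>i\<in>{1..n}. N (replace_tuple n y i x) \<le> M"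
    by blast
next
  assume "\<exists>M>0. \<forall>x\<in>K. \<forall>i\<in>{1..n}. N (replace_tuple n y i x) \<le> M"
  then obtain M where M: "M > 0"
    "\<And>x i. x \<in> K \<Longrightarrow> i \<in> {1..n} \<Longrightarrow> N (replace_tuple n y i x) \<le> M"
    by blast
  have "quotient_norm N n y I (x +o Y0 n y I) \<le> real m * M"
    if x: "x \<in> K" and I: "I \<in> class_indices n m" for x I
  proof -
    from I have sub: "I \<subseteq> {1..n}" and card: "card I = m"
      by (auto simp: class_indices_def)
    have "(\<Sum>i\<in>I. N (replace_tuple n y i x)) \<le> of_nat (card I) * M"
      using M(2) x sub by (intro sum_bounded_above) blast
    then show ?thesis
      using quotient_norm_coset[OF sub] card by simp
  qed
  moreover have "real m * M > 0"
    using m M(1) by simp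
  ultimately show "class_bounded N n y m K"
    unfolding class_bounded_def by blast
qed

theorem theorem2p9:
  fixes n :: nat
    and N :: "'a::real_vector list \<Rightarrow> real"
    and y :: "nat \<Rightarrow> 'a"
    and K :: "'a set"
  assumes "n \<ge> 1"
    and "n_norm n N"
    and "inj_on y {1..n}"
    and "independent (y ` {1..n})"
    and "K \<noteq> {}"
  shows "\<forall>m\<in>{1..n}. class_bounded N n y 1 K \<longleftrightarrow> class_bounded N n y m K"
proof
  interpret n_norm n N
    by fact
  fix m assume "m \<in> {1..n}"
  moreover have "1 \<in> {1..n}"
    using assms(1) by simp
  ultimately show "class_bounded N n y 1 K \<longleftrightarrow> class_bounded N n y m K"
    by (simp only: class_bounded_iff_replace_tuple_bounded)
qed

end
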